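(* Let $a,b\in\mathbb{Z}$, let $f(x)\in\mathbb{Z}[[x]]$ be the formal power series defined by $$f(x)=\frac{1}{1-ax-(b-1)x^2-x^2f(x)},$$ and let $a_n$ ($n\ge0$) denote the $n$-th element of the first column of the Riordan array $(f(x),x)$, i.e. $a_n=[x^n]f(x)$. Then for every $n\ge 0$, $$a_n=\sum_{k=0}^{\lfloor n/2\rfloor}\binom{n-k}{k}(b-1)^k\sum_{j=0}^{n-2k}\binom{n-2k}{j}a^{n-2k-j}\,C_{\frac{j}{2}}\,\frac{1+(-1)^j}{2},$$ where $C_n=\frac{1}{n+1}\binom{2n}{n}$ is the $n$-th Catalan number.
   Context: $[x^n]f(x)$ denotes the coefficient of $x^n$ in $f(x)$. The Riordan array $(f(x),x)$ is the infinite lower-triangular matrix whose $i$-th column ($i=0,1,2,\dots$) has generating function $f(x)x^i$. The equation defining $f$ determines a unique formal power series, with constant term $1$. In the sum, the terms with $j$ odd are taken to be $0$ (the factor $\frac{1+(-1)^j}{2}$ vanishes), so only even $j$ contribute, with factor $C_{j/2}$. The convention $0^0=1$ is used. *)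

theory Defs
  imports "HOL-Computational_Algebra.Formal_Power_Series"
begin

(* Entry in row n, column k of the Riordan array (g, h). *)
definition riordan_array :: "'a::comm_ring_1 fps \<Rightarrow> 'a fps \<Rightarrow> nat \<Rightarrow> nat \<Rightarrow> 'a" where
  "riordan_array g h n k = fps_nth (g * h ^ k) n"

definition catalan :: "nat \<Rightarrow> rat" where
  "catalan n = 1 / of_nat (n + 1) * of_nat ((2 * n) choose n)"

(* f = 1 / (1 - a x - (b-1) x^2 - x^2 f) in Z[[x]].  There is no division on int fps, so the
   reciprocal is expressed by its defining property in the ring of power series. *)
definition generating_equation :: "int \<Rightarrow> int \<Rightarrow> int fps \<Rightarrow> bool" where
  "generating_equation a b f \<longleftrightarrow>
     f * (1 - fps_const a * fps_X - fps_const (b - 1) * fps_X ^ 2 - fps_X ^ 2 * f) = 1"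

(* The coefficients of the unique solution; used only to show that the equation determines f. *)
fun gen_coeff :: "int \<Rightarrow> int \<Rightarrow> nat \<Rightarrow> int" where
  "gen_coeff a b 0 = 1"
| "gen_coeff a b (Suc 0) = a"
| "gen_coeff a b (Suc (Suc n)) =
     a * gen_coeff a b (Suc n) + (b - 1) * gen_coeff a b n
     + (\<Sum>i=0..n. gen_coeff a b i * gen_coeff a b (n - i))"

lemma generating_equation_iff:
  "generating_equation a b f \<longleftrightarrow>
     fps_nth f 0 = 1 \<and> fps_nth f (Suc 0) = a \<and>
     (\<forall>n. fps_nth f (Suc (Suc n)) =
        a * fps_nth f (Suc n) + (b - 1) * fps_nth f n
        + (\<Sum>i=0..n. fps_nth f i * fps_nth f (n - i)))"
proof -
  define r where "r = 1 + fps_X * (fps_const a * f) + fps_X * (fps_X * (fps_const (b - 1) * f + f * f))"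
  have r: "fps_nth r 0 = 1" "fps_nth r (Suc 0) = a * fps_nth f 0"
    "fps_nth r (Suc (Suc n)) = a * fps_nth f (Suc n) + (b - 1) * fps_nth f n
        + (\<Sum>i=0..n. fps_nth f i * fps_nth f (n - i))" for n
    by (simp_all add: r_def fps_mult_nth[of f f])
  have "generating_equation a b f \<longleftrightarrow> f = r"
    unfolding generating_equation_def r_def by (auto simp: algebra_simps power2_eq_square)
  also have "\<dots> \<longleftrightarrow> fps_nth f 0 = fps_nth r 0 \<and> fps_nth f (Suc 0) = fps_nth r (Suc 0) \<and>
      (\<forall>n. fps_nth f (Suc (Suc n)) = fps_nth r (Suc (Suc n)))"
    unfolding fps_eq_iff by (metis not0_implies_Suc)
  finally show ?thesis by (auto simp: r)
qed

lemma generating_equation_unique: "\<exists>!f. generating_equation a b f"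
proof (rule ex1I[of _ "Abs_fps (gen_coeff a b)"])
  show "generating_equation a b (Abs_fps (gen_coeff a b))"
    by (simp add: generating_equation_iff)
next
  fix f assume f: "generating_equation a b f"
  have "fps_nth f n = gen_coeff a b n" for n
  proof (induction n rule: less_induct)
    case (less n)
    show ?case
    proof (cases "n < 2")
      case True
      then show ?thesis using f
        by (auto simp: generating_equation_iff less_2_cases_iff)
    next
      case False
      then obtain m where n: "n = Suc (Suc m)"
        by (metis add_2_eq_Suc le_Suc_ex not_less)
      have "(\<Sum>i=0..m. fps_nth f i * fps_nth f (m - i)) =
            (\<Sum>i=0..m. gen_coeff a b i * gen_coeff a b (m - i))"
        by (intro sum.cong refl) (simp add: less n)
      then show ?thesis using f less[of m] less[of "Suc m"]
        by (simp add: generating_equation_iff n)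
    qed
  qed
  then show "f = Abs_fps (gen_coeff a b)" by (simp add: fps_eq_iff)
qed

end

theory Submission
  imports Defs
begin

unbundle fps_syntax

(* Let E(x) = C(x^2) be the aerated Catalan series, so that E (1 - x^2 E) = 1.  If g satisfies
   g (1 - c x - x^2 g) = 1, then h = t g(x t) satisfies h (1/t - c x - x^2 h) = 1.  Applying this to
   E with 1/t = 1 - a x, and to the result with 1/t = 1 - (b - 1) x^2, produces f; reading off the
   coefficients gives the inner and the outer sum respectively.  The quadratic equation of C holds because the
   Catalan recurrence makes (1 - 2 x C)^2 a solution of (1 - 4 x) s' = - 4 s with s(0) = 1, and
   1 - 4 x is the only one. *)

lemma catalan_recurrence: "of_nat (n + 2) * catalan (Suc n) = of_nat (4 * n + 2) * catalan n"
proof -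
  have *: "catalan n = fact (2 * n) / (fact n * fact (Suc n))" for n
    by (simp add: catalan_def binomial_fact)
  show ?thesis
    unfolding * by (simp add: divide_simps) (simp add: algebra_simps)
qed

lemma catalan_fps_equation:
  defines "c \<equiv> Abs_fps catalan"
  shows "c * (1 - fps_X * c) = 1"
proof -
  \<comment> \<open>The closed form C = (1 - sqrt (1 - 4 x)) / (2 x) suggests this series: it should
    be a square root of 1 - 4 x.\<close>
  define h where "h = 1 - 2 * fps_X * c"
  have h_nth: "h $ n = (case n of 0 \<Rightarrow> 1 | Suc m \<Rightarrow> - 2 * catalan m)" for n
    by (simp add: h_def c_def mult.assoc numeral_fps_const split: nat.split)
  have h: "(1 - 4 * fps_X) * fps_deriv h = - (2 * h)"
  proof (rule fps_ext)
    fix n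
    show "((1 - 4 * fps_X) * fps_deriv h) $ n = (- (2 * h)) $ n"
    proof (cases n)
      case 0
      then show ?thesis
        by (simp add: h_nth catalan_def)
    next
      case (Suc m)
      \<comment> \<open>Up to a factor -2, the coefficient equation at \<open>Suc m\<close> is the
        Catalan recurrence at \<open>m\<close>.\<close>
      then show ?thesis using catalan_recurrence[of m]
        by (simp add: h_nth numeral_fps_const algebra_simps mult.assoc[of _ fps_X])
    qed
  qed
  define s where "s = h ^ 2"
  have "(1 - 4 * fps_X) * fps_deriv s = 2 * h * ((1 - 4 * fps_X) * fps_deriv h)"
    by (simp add: s_def fps_deriv_power' algebra_simps)
  also have "\<dots> = - (4 * s)"
    by (simp add: h s_def power2_eq_square)
  finally have s: "(1 - 4 * fps_X) * fps_deriv s = - (4 * s)" .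
  have s_rec: "of_nat (Suc n) * s $ Suc n = (4 * of_nat n - 4) * s $ n" for n
    using arg_cong[OF s, of "\<lambda>g. g $ n"]
    by (cases n) (simp_all add: numeral_fps_const algebra_simps mult.assoc[of _ fps_X])
  have s0: "s $ 0 = 1"
    by (simp add: s_def h_nth power2_eq_square)
  have s1: "s $ Suc 0 = - 4"
    using s_rec[of 0] s0 by simp
  \<comment> \<open>The factor 4 n - 4 in \<open>s_rec\<close> vanishes at n = 1, which kills the
    coefficient of x^2; every later coefficient is a multiple of the one before.\<close>
  have s2: "s $ Suc (Suc n) = 0" for n
  proof (induction n)
    case 0
    show ?case using s_rec[of 1] by simp
  next
    case (Suc n)
    then show ?case using s_rec[of "Suc (Suc n)"] by (simp del: of_nat_Suc)
  qed
  have "s $ n = (1 - 4 * fps_X) $ n" for n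
    by (cases n rule: nat.exhaust; cases "n - 1") (auto simp: s0 s1 s2 numeral_fps_const)
  then have "s = 1 - 4 * fps_X"
    by (simp add: fps_eq_iff)
  \<comment> \<open>Expanding (1 - 2 x c)^2 = 1 - 4 x gives the quadratic equation multiplied by 4
    x, which can be cancelled in an integral domain.\<close>
  then have "4 * fps_X * (c * (1 - fps_X * c)) = 4 * fps_X * 1"
    by (simp add: s_def h_def power2_eq_square algebra_simps)
  then show ?thesis
    by (subst (asm) mult_cancel_left) simp
qed

lemma fps_nth_compose_X_squared:
  "((f :: 'a :: comm_ring_1 fps) oo fps_X ^ 2) $ n = (if even n then f $ (n div 2) else 0)"
proof -
  have "(f oo fps_X ^ 2) $ n = (\<Sum>i=0..n. if n = 2 * i then f $ i else 0)"
    unfolding fps_compose_nth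
    by (intro sum.cong refl) (simp add: power_mult [symmetric])
  also have "\<dots> = (if even n then f $ (n div 2) else 0)"
    by (auto elim!: evenE simp: sum.delta' intro!: sum.neutral)
  finally show ?thesis .
qed

text \<open>With y = x t and N = g(y), the equation of \<open>g\<close> holds for N in the variable
  y, and h = t N turns x h into y N. The series \<open>v\<close> plays the role of 1/t; it stays
  arbitrary so that both 1 - a x and 1 - (b - 1) x^2 can be inserted.\<close>

lemma quadratic_fps_substitution:
  fixes g t v :: "'a :: field fps"
  assumes g: "g * (1 - fps_const c * fps_X - fps_X ^ 2 * g) = 1"
    and t: "t * v = 1"
    and h: "h = t * (g oo (fps_X * t))"
  shows "h * (v - fps_const c * fps_X - fps_X ^ 2 * h) = 1"
proof -
  define y where "y = fps_X * t"
  define N where "N = g oo y"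
  have y0: "y $ 0 = 0" by (simp add: y_def)
  have "fps_X oo y = y"
    using y0 by (simp add: fps_X_fps_compose fps_eq_iff)
  then have "N * (1 - fps_const c * y - y ^ 2 * N) = 1"
    using arg_cong[OF g, of "\<lambda>z. z oo y"] y0
    by (simp add: N_def fps_compose_mult_distrib fps_compose_sub_distrib fps_compose_power [symmetric])
  moreover have "h * (v - fps_const c * fps_X - fps_X ^ 2 * h)
      = N * (t * v - fps_const c * y - y ^ 2 * N)"
    by (simp add: h N_def y_def algebra_simps power2_eq_square)
  ultimately show ?thesis by (simp add: t)
qed

text \<open>Subtracting the equations leaves a product with the factor f - g; the other factor has
  constant term \<open>u $ 0\<close>, hence is nonzero.\<close>

lemma quadratic_fps_unique:
  fixes f g u :: "'a :: idom fps"
  assumes f: "f * (u - fps_X ^ 2 * f) = 1" and g: "g * (u - fps_X ^ 2 * g) = 1"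
    and u: "u $ 0 \<noteq> 0"
  shows "f = g"
proof -
  have "(u - fps_X ^ 2 * (f + g)) $ 0 \<noteq> 0"
    using u by (simp add: power2_eq_square mult.assoc)
  then have "u - fps_X ^ 2 * (f + g) \<noteq> 0" by (metis fps_zero_nth)
  moreover have "(f - g) * (u - fps_X ^ 2 * (f + g)) = 0"
    using f g by (simp add: algebra_simps)
  ultimately show ?thesis by simp
qed

text \<open>The term of index m is t (x t)^m = x^m t^(m+1), so the power of x only shifts the
  index.\<close>

lemma fps_nth_mult_compose:
  fixes g t :: "'a :: comm_ring_1 fps"
  shows "(t * (g oo (fps_X * t))) $ n = (\<Sum>m=0..n. g $ m * (t ^ Suc m) $ (n - m))"
proof -
  have "(t * (g oo (fps_X * t))) $ n
      = (\<Sum>i=0..n. \<Sum>m=0..n-i. t $ i * (g $ m * ((fps_X * t) ^ m) $ (n - i)))"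
    by (simp add: fps_mult_nth fps_compose_nth sum_distrib_left)
  \<comment> \<open>The added terms vanish because (x t)^m has no coefficient below index m; with
    independent ranges the sums can be swapped.\<close>
  also have "\<dots> = (\<Sum>i=0..n. \<Sum>m=0..n. t $ i * (g $ m * ((fps_X * t) ^ m) $ (n - i)))"
    by (intro sum.cong refl sum.mono_neutral_left)
       (auto simp: power_mult_distrib fps_X_power_mult_nth)
  also have "\<dots> = (\<Sum>m=0..n. g $ m * (t * (fps_X * t) ^ m) $ n)"
    by (subst sum.swap) (simp add: fps_mult_nth[of t] sum_distrib_left mult_ac)
  also have "\<dots> = (\<Sum>m=0..n. g $ m * (fps_X ^ m * t ^ Suc m) $ n)"
    by (simp add: power_mult_distrib mult_ac)
  finally show ?thesis
    by (simp add: fps_X_power_mult_nth)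
qed

lemma of_int_fps_mult:
  "Abs_fps (\<lambda>n. (of_int ((f * g) $ n) :: 'a :: comm_ring_1)) =
     Abs_fps (\<lambda>n. of_int (f $ n)) * Abs_fps (\<lambda>n. of_int (g $ n))"
  by (simp add: fps_eq_iff fps_mult_nth)

text \<open>Applying \<open>of_int\<close> to each coefficient is a ring homomorphism. This moves
  the equation to the rationals, where the Catalan numbers and the inverse series live.\<close>

lemma of_int_generating_equation:
  fixes F :: "'a :: comm_ring_1 fps"
  assumes "generating_equation a b f" and "F = Abs_fps (\<lambda>n. of_int (f $ n))"
  shows "F * (1 - fps_const (of_int a) * fps_X - fps_const (of_int (b - 1)) * fps_X ^ 2
           - fps_X ^ 2 * F) = 1"
proof -
  define \<phi> :: "int fps \<Rightarrow> 'a fps" where "\<phi> g = Abs_fps (\<lambda>n. of_int (g $ n))" for g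
  have mult: "\<phi> (g * h) = \<phi> g * \<phi> h" for g h
    unfolding \<phi>_def by (rule of_int_fps_mult)
  have diff: "\<phi> (g - h) = \<phi> g - \<phi> h" for g h
    by (simp add: \<phi>_def fps_eq_iff)
  have atoms: "\<phi> 1 = 1" "\<phi> fps_X = fps_X" "\<phi> (fps_const k) = fps_const (of_int k)" for k
    by (simp_all add: \<phi>_def fps_eq_iff)
  have "\<phi> (f * (1 - fps_const a * fps_X - fps_const (b - 1) * fps_X ^ 2 - fps_X ^ 2 * f)) = \<phi> 1"
    using assms(1) by (simp add: generating_equation_def)
  then show ?thesis
    using assms(2) by (simp only: mult diff atoms power2_eq_square \<phi>_def [of f, symmetric])
qed

theorem corollary4:
  fixes a b :: int and f :: "int fps" and n :: nat
  assumes "generating_equation a b f"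
  shows "(of_int (riordan_array f fps_X n 0) :: rat) =
    (\<Sum>k=0..n div 2. of_nat ((n - k) choose k) * of_int (b - 1) ^ k *
      (\<Sum>j=0..n - 2 * k. of_nat ((n - 2 * k) choose j) * of_int a ^ (n - 2 * k - j)
         * catalan (j div 2) * ((1 + (-1) ^ j) / 2)))"
proof -
  define A :: rat where "A = of_int a"
  define B :: rat where "B = of_int (b - 1)"
  define F :: "rat fps" where "F = Abs_fps (\<lambda>n. of_int (f $ n))"
  have neg_power: "(inverse (1 - fps_const c * fps_X) ^ Suc m) $ s = of_nat ((m + s) choose s) * c ^ s"
    for c :: rat and m s
    using one_minus_const_fps_X_neg_power'[of "Suc m" c]
    by (simp add: fps_inverse_power [symmetric] del: power_Suc)

  define E where "E = Abs_fps catalan oo fps_X ^ 2"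
  have X2: "(fps_X ^ 2 :: rat fps) $ 0 = 0" by simp
  have XX2: "fps_X oo fps_X ^ 2 = (fps_X ^ 2 :: rat fps)"
    by (simp add: fps_X_fps_compose fps_eq_iff)
  \<comment> \<open>The zero linear coefficient is written out to match the form required by the
    substitution lemma.\<close>
  have E: "E * (1 - fps_const 0 * fps_X - fps_X ^ 2 * E) = 1"
    using arg_cong[OF catalan_fps_equation, of "\<lambda>z. z oo fps_X ^ 2"]
    by (simp add: E_def fps_compose_mult_distrib[OF X2] fps_compose_sub_distrib XX2)

  define t where "t = inverse (1 - fps_const A * fps_X)"
  define M where "M = t * (E oo (fps_X * t))"
  have "t * (1 - fps_const A * fps_X) = 1"
    unfolding t_def by (rule inverse_mult_eq_1) simp
  then have M: "M * (1 - fps_const A * fps_X - fps_X ^ 2 * M) = 1"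
    using quadratic_fps_substitution[OF E _ M_def] by simp
  have M_nth: "M $ m = (\<Sum>j=0..m. of_nat (m choose j) * A ^ (m - j)
         * catalan (j div 2) * ((1 + (-1) ^ j) / 2))" for m
    unfolding M_def fps_nth_mult_compose t_def neg_power E_def fps_nth_compose_X_squared
    by (intro sum.cong refl) (auto simp: binomial_symmetric[symmetric])

  define w where "w = inverse (1 - fps_const B * fps_X ^ 2)"
  define G where "G = w * (M oo (fps_X * w))"
  have "w * (1 - fps_const B * fps_X ^ 2) = 1"
    unfolding w_def by (rule inverse_mult_eq_1) simp
  from quadratic_fps_substitution[OF M this G_def]
  have "G * ((1 - fps_const A * fps_X - fps_const B * fps_X ^ 2) - fps_X ^ 2 * G) = 1"
    by (simp add: algebra_simps)
  moreover have "F * ((1 - fps_const A * fps_X - fps_const B * fps_X ^ 2) - fps_X ^ 2 * F) = 1"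
    using of_int_generating_equation[OF assms F_def] by (simp add: A_def B_def)
  ultimately have "G = F"
    by (rule quadratic_fps_unique) (simp add: power2_eq_square mult.assoc[of _ fps_X])

  \<comment> \<open>Written as a series in x^2, \<open>w\<close> has powers that
    \<open>neg_power\<close> computes.\<close>
  have w_eq: "w = inverse (1 - fps_const B * fps_X) oo fps_X ^ 2"
    unfolding w_def
    by (subst fps_inverse_compose)
       (simp_all add: fps_compose_sub_distrib fps_compose_mult_distrib[OF X2] XX2)
  have w_nth: "(w ^ Suc m) $ s =
      (if even s then of_nat ((m + s div 2) choose (s div 2)) * B ^ (s div 2) else 0)" for m s
    unfolding w_eq fps_compose_power[OF X2] fps_nth_compose_X_squared neg_power ..

  have "of_int (riordan_array f fps_X n 0) = G $ n"
    using \<open>G = F\<close> by (auto simp: riordan_array_def F_def)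
  also have "\<dots> = (\<Sum>m=0..n. M $ m * (w ^ Suc m) $ (n - m))"
    unfolding G_def by (rule fps_nth_mult_compose)
  also have "\<dots> = (\<Sum>m | m \<le> n \<and> even (n - m). M $ m * (w ^ Suc m) $ (n - m))"
    by (intro sum.mono_neutral_right) (auto simp: w_nth simp del: power_Suc)
  also have "\<dots> = (\<Sum>k=0..n div 2. M $ (n - 2 * k) * (w ^ Suc (n - 2 * k)) $ (2 * k))"
    by (intro sum.reindex_bij_witness[of _ "\<lambda>k. n - 2 * k" "\<lambda>m. (n - m) div 2"])
       (auto simp del: power_Suc elim!: evenE)
  \<comment> \<open>For m = n - 2 k and s = 2 k, the binomial top m + s div 2 becomes n - k.\<close>
  also have "\<dots> = (\<Sum>k=0..n div 2. of_nat ((n - k) choose k) * B ^ k * M $ (n - 2 * k))"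
    by (intro sum.cong refl) (auto simp: w_nth simp del: power_Suc)
  finally show ?thesis
    by (simp only: M_nth A_def B_def)
qed

end
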